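(* Let $\Omega = X\times\mathbb{R}^n$ with $X=\mathbb{R}^n$ or $X=\mathbb{T}^n$, and let $f,g\in C^\infty(\Omega)$ be strictly positive with $\int_\Omega f\,dx\,dv=\int_\Omega g\,dx\,dv$. Let $V=V(x,t)$ be a time-dependent potential, and let $\rho=\rho(x,v,t)$ be the solution of the Liouville equation $$\partial_t\rho+v\cdot\nabla_x\rho-\nabla_xV(x,t)\cdot\nabla_v\rho=0,\qquad \rho(\cdot,0)=f,$$ such that $\rho(\cdot,1)=g$. Then $f$ and $g$ are equimeasurable, namely $$\int_\Omega \Phi(f(x,v))\,dx\,dv=\int_\Omega\Phi(g(x,v))\,dx\,dv$$ for any measurable function $\Phi:\mathbb{R}\to\mathbb{R}$.
   Context: $\mathbb{T}^n$ is the $n$-dimensional torus; points of $\Omega$ are written $(x,v)$ with $x\in X$, $v\in\mathbb{R}^n$. Here $\rho(\cdot,t)$ denotes the function $(x,v)\mapsto\rho(x,v,t)$ on $\Omega$. The equation is the Liouville equation for the phase-space dynamics $\dot x=v$, $\dot v=-\nabla_xV(x,t)$, which is the Hamiltonian system with Hamiltonian $H(x,v,t)=\tfrac12|v|^2+V(x,t)$.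
   Formalization: For X = R^n the Hamiltonian flow of V is additionally assumed to exist for all times in [0,1] through every phase point; otherwise (e.g. V = -x^4) mass entering from infinity makes the claim false. *)

theory Defs
  imports "HOL-Analysis.Analysis"
begin

text \<open>
  The configuration space is either Euclidean space or the flat torus (real vectors modulo integer
  vectors).  It is written as the quotient of \<open>real^'n\<close> by a group of periods, trivial in the
  Euclidean case.  A function on the quotient is represented by its lift, a function on \<open>real^'n\<close>
  invariant under the periods; smoothness and derivatives on the quotient are those of the lift, and
  integrals are taken over a fundamental cell.
\<close>

datatype config_space = Euclidean | Torus

fun periods :: "config_space \<Rightarrow> (real^'n) set" where
  "periods Euclidean = {0}"
| "periods Torus = {k. \<forall>i. k $ i \<in> \<int>}"

fun cell :: "config_space \<Rightarrow> (real^'n) set" where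
  "cell Euclidean = UNIV"
| "cell Torus = {x. \<forall>i. 0 \<le> x $ i \<and> x $ i < 1}"

definition config_invariant :: "config_space \<Rightarrow> (real^'n \<Rightarrow> 'a) \<Rightarrow> bool" where
  "config_invariant X h \<longleftrightarrow> (\<forall>k\<in>periods X. \<forall>x. h (x + k) = h x)"

definition phase_measure :: "config_space \<Rightarrow> ((real^'n) \<times> (real^'n)) measure" where
  "phase_measure X = restrict_space lborel (cell X \<times> UNIV)"

primrec Ck :: "nat \<Rightarrow> ('a::euclidean_space \<Rightarrow> real) \<Rightarrow> bool" where
  "Ck 0 h \<longleftrightarrow> continuous_on UNIV h"
| "Ck (Suc k) h \<longleftrightarrow> (\<forall>z. h differentiable (at z)) \<and>
     (\<forall>b\<in>Basis. Ck k (\<lambda>z. frechet_derivative h (at z) b))"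

definition smooth_on_phase_space :: "config_space \<Rightarrow> ((real^'n) \<times> (real^'n) \<Rightarrow> real) \<Rightarrow> bool" where
  "smooth_on_phase_space X f \<longleftrightarrow>
     (\<forall>v. config_invariant X (\<lambda>x. f (x, v))) \<and> (\<forall>k. Ck k f)"

definition grad :: "('a::real_inner \<Rightarrow> real) \<Rightarrow> 'a \<Rightarrow> 'a" where
  "grad h x = (THE D. GDERIV h x :> D)"

lemma grad_eq: "GDERIV h x :> D \<Longrightarrow> grad h x = D"
  unfolding grad_def
proof (rule the_equality)
  fix D' assume "GDERIV h x :> D" "GDERIV h x :> D'"
  then have "(\<lambda>y. y \<bullet> D') = (\<lambda>y. y \<bullet> D)"
    unfolding gderiv_def by (rule has_derivative_unique[rotated])
  then have "(D' - D) \<bullet> D' = (D' - D) \<bullet> D" by meson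
  then have "(D' - D) \<bullet> (D' - D) = 0" by (simp add: inner_diff_right)
  then show "D' = D" by simp
qed

text \<open>
  Time-dependent potentials on the time interval from 0 to 1.  The force is only required to satisfy
  the Cauchy-Lipschitz conditions, under which the equations of motion have unique local solutions;
  every potential that is smooth in \<open>(x, t)\<close> satisfies them.
\<close>

definition potential :: "config_space \<Rightarrow> (real^'n \<Rightarrow> real \<Rightarrow> real) \<Rightarrow> bool" where
  "potential X V \<longleftrightarrow>
     (\<forall>t\<in>{0..1}. config_invariant X (\<lambda>x. V x t) \<and> (\<forall>x. (\<lambda>y. V y t) differentiable (at x))) \<and>
     continuous_on ({0..1} \<times> UNIV) (\<lambda>(t, x). grad (\<lambda>y. V y t) x) \<and>
     local_lipschitz {0..1} UNIV (\<lambda>t x. grad (\<lambda>y. V y t) x)"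

definition hamiltonian_trajectory ::
    "(real^'n \<Rightarrow> real \<Rightarrow> real) \<Rightarrow> (real \<Rightarrow> real^'n) \<Rightarrow> (real \<Rightarrow> real^'n) \<Rightarrow> bool" where
  "hamiltonian_trajectory V x v \<longleftrightarrow>
     (\<forall>t\<in>{0..1}. (x has_vector_derivative v t) (at t within {0..1}) \<and>
                 (v has_vector_derivative - grad (\<lambda>y. V y t) (x t)) (at t within {0..1}))"

text \<open>
  The Hamiltonian system generates a flow of the whole phase space over the time interval from 0
  to 1.  On the torus this holds for every potential, as the force is bounded.  On Euclidean space
  particles may reach, or come from, infinity in finite time; then the initial datum need not
  determine the solution of the Liouville equation, and mass may be lost to or gained from infinity.
\<close>

definition global_hamiltonian_flow :: "(real^'n \<Rightarrow> real \<Rightarrow> real) \<Rightarrow> bool" where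
  "global_hamiltonian_flow V \<longleftrightarrow>
     (\<forall>s\<in>{0..1}. \<forall>x0 v0. \<exists>x v. hamiltonian_trajectory V x v \<and> x s = x0 \<and> v s = v0)"

text \<open>
  Classical solutions: continuous up to the end times, and differentiable jointly in all variables
  in between.  This includes solutions that are continuously differentiable up to the end times.
\<close>

definition liouville_solution ::
    "config_space \<Rightarrow> (real^'n \<Rightarrow> real \<Rightarrow> real) \<Rightarrow> (real^'n \<Rightarrow> real^'n \<Rightarrow> real \<Rightarrow> real) \<Rightarrow> bool" where
  "liouville_solution X V \<rho> \<longleftrightarrow>
     (\<forall>t\<in>{0..1}. \<forall>v. config_invariant X (\<lambda>x. \<rho> x v t)) \<and>
     continuous_on (UNIV \<times> UNIV \<times> {0..1}) (\<lambda>(x, v, t). \<rho> x v t) \<and>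
     (\<forall>x v. \<forall>t\<in>{0<..<1}.
        (\<lambda>(x, v, t). \<rho> x v t) differentiable (at (x, v, t)) \<and>
        deriv (\<lambda>s. \<rho> x v s) t + v \<bullet> grad (\<lambda>y. \<rho> y v t) x
          - grad (\<lambda>y. V y t) x \<bullet> grad (\<lambda>w. \<rho> x w t) v = 0)"

text \<open>
  Equality of the integrals of \<open>\<Phi> \<circ> f\<close> and \<open>\<Phi> \<circ> g\<close> for Borel functions \<open>\<Phi>\<close>, including
  the cases where they are infinite or undefined: the first conjunct, for \<open>\<Phi>\<close> and for
  \<open>-\<Phi>\<close>, equates the integrals of the positive and of the negative parts in \<open>[0, \<infinity>]\<close>.
\<close>

definition equimeasurable :: "'a measure \<Rightarrow> ('a \<Rightarrow> real) \<Rightarrow> ('a \<Rightarrow> real) \<Rightarrow> bool" where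
  "equimeasurable M f g \<longleftrightarrow>
     (\<forall>\<Phi> :: real \<Rightarrow> real. \<Phi> \<in> borel_measurable borel \<longrightarrow>
        (\<integral>\<^sup>+ z. ennreal (\<Phi> (f z)) \<partial>M) = (\<integral>\<^sup>+ z. ennreal (\<Phi> (g z)) \<partial>M) \<and>
        (integrable M (\<lambda>z. \<Phi> (f z)) \<longleftrightarrow> integrable M (\<lambda>z. \<Phi> (g z))) \<and>
        (\<integral>z. \<Phi> (f z) \<partial>M) = (\<integral>z. \<Phi> (g z) \<partial>M))"

end

theory Submission
  imports Defs
begin

text \<open>
  A classical solution of the Liouville equation is constant along trajectories, so \<open>f = g \<circ> T\<close> for
  the time-one map \<open>T\<close> of the Hamiltonian system, and it remains to see that \<open>T\<close> preserves volume.
  The force is merely Lipschitz, so \<open>T\<close> need not be differentiable and its Jacobian is not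
  available.  Instead \<open>T\<close> is the pointwise limit of the symplectic Euler scheme, whose steps are
  compositions of two shears and preserve volume exactly.  By Fatou's lemma the preimage under \<open>T\<close>
  of an open set is not larger than the set; outer regularity extends this to Borel sets, and the
  time-reversed system gives the opposite inequality.  On the torus the lifted map commutes with the
  periods, and an invariant function has the same integral over all fundamental domains.
\<close>

subsection \<open>Symplectic Euler approximation\<close>

text \<open>On each ball one constant serves all times in the unit interval; the error estimate in a
  tube around a trajectory needs this uniformity.\<close>

definition lipschitz_force :: "(real \<Rightarrow> 'a::euclidean_space \<Rightarrow> 'a) \<Rightarrow> bool" where
  "lipschitz_force G \<longleftrightarrow> continuous_on ({0..1} \<times> UNIV) (\<lambda>(t, x). G t x) \<and>
     (\<forall>r. \<exists>L. \<forall>t\<in>{0..1}. L-lipschitz_on (cball 0 r) (G t))"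

text \<open>The factor \<open>a\<close> is there for time reversal, which replaces \<open>a = 1\<close> by \<open>a = -1\<close>.\<close>

definition newton_trajectory ::
    "real \<Rightarrow> (real \<Rightarrow> 'a::euclidean_space \<Rightarrow> 'a) \<Rightarrow> (real \<Rightarrow> 'a) \<Rightarrow> (real \<Rightarrow> 'a) \<Rightarrow> bool" where
  "newton_trajectory a G x v \<longleftrightarrow>
     (\<forall>t\<in>{0..1}. (x has_vector_derivative a *\<^sub>R v t) (at t within {0..1}) \<and>
                 (v has_vector_derivative G t (x t)) (at t within {0..1}))"

text \<open>The right-hand factor acts first: the velocity is kicked by the force at the old
  position, then the position drifts with the new velocity. This order makes each half a
  shear.\<close>

definition euler_step ::
    "real \<Rightarrow> (real \<Rightarrow> 'a::euclidean_space \<Rightarrow> 'a) \<Rightarrow> real \<Rightarrow> real \<Rightarrow> 'a \<times> 'a \<Rightarrow> 'a \<times> 'a" where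
  "euler_step a G h t = (\<lambda>(x, v). (x + (h * a) *\<^sub>R v, v)) \<circ> (\<lambda>(x, v). (x, v + h *\<^sub>R G t x))"

primrec symplectic_euler ::
    "real \<Rightarrow> (real \<Rightarrow> 'a::euclidean_space \<Rightarrow> 'a) \<Rightarrow> real \<Rightarrow> nat \<Rightarrow> 'a \<times> 'a \<Rightarrow> 'a \<times> 'a" where
  "symplectic_euler a G h 0 = id"
| "symplectic_euler a G h (Suc k) = euler_step a G h (real k * h) \<circ> symplectic_euler a G h k"

lemma lipschitz_force_continuous_on:
  assumes "lipschitz_force G" "t \<in> {0..1}"
  shows "continuous_on UNIV (G t)"
proof -
  have "continuous_on UNIV (\<lambda>x. (\<lambda>(t, x). G t x) (t, x))"
    by (rule continuous_on_compose2[of "{0..1} \<times> UNIV"])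
      (use assms in \<open>auto simp: lipschitz_force_def intro!: continuous_intros\<close>)
  then show ?thesis by simp
qed

lemma newton_trajectory_continuous_on:
  assumes "newton_trajectory a G x v"
  shows "continuous_on {0..1} x" "continuous_on {0..1} v"
  using assms unfolding newton_trajectory_def
  by (auto simp: continuous_on_eq_continuous_within
      intro!: has_vector_derivative_continuous)

lemma force_along_continuous_on:
  assumes G: "lipschitz_force G" and x: "continuous_on {0..1} x"
  shows "continuous_on {0..1} (\<lambda>t. G t (x t))"
proof -
  have "continuous_on {0..1} (\<lambda>t. (\<lambda>(t, x). G t x) (t, x t))"
    by (rule continuous_on_compose2[of "{0..1} \<times> UNIV"])
      (use assms in \<open>auto simp: lipschitz_force_def intro!: continuous_intros\<close>)
  then show ?thesis by simp
qed

lemma uniform_modulus: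
  fixes u :: "real \<Rightarrow> 'a::metric_space"
  assumes u: "continuous_on {0..1} u" and "\<omega> > 0"
  shows "\<exists>\<delta>>0. \<forall>s\<in>{0..1}. \<forall>t\<in>{0..1}. \<bar>s - t\<bar> < \<delta> \<longrightarrow> dist (u s) (u t) < \<omega>"
  using compact_uniformly_continuous[OF u compact_Icc] \<open>\<omega> > 0\<close>
  unfolding uniformly_continuous_on_def dist_real_def by (metis)

text \<open>Mean value inequality for \<open>u\<close> minus its linearization at \<open>r\<close>.
  The point \<open>r\<close> is free in \<open>{s..t}\<close>, so the derivative can be frozen at
  either end of the step.\<close>

lemma increment_bound:
  fixes u :: "real \<Rightarrow> 'a::real_normed_vector"
  assumes u: "\<And>t. t \<in> {0..1} \<Longrightarrow> (u has_vector_derivative u' t) (at t within {0..1})"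
    and st: "0 \<le> s" "s \<le> t" "t \<le> 1" and r: "r \<in> {s..t}"
    and B: "\<And>q. q \<in> {s..t} \<Longrightarrow> norm (u' q - u' r) \<le> B"
  shows "norm (u t - u s - (t - s) *\<^sub>R u' r) \<le> (t - s) * B"
proof -
  have "norm (u t - u s - (t - s) *\<^sub>R u' r) \<le> norm (t - s) * B"
    by (rule vector_differentiable_bound_linearization[where S = "{s..t}"])
      (use st r B in \<open>auto simp: closed_segment_eq_real_ivl
         intro!: has_vector_derivative_within_subset[OF u]\<close>)
  then show ?thesis using st by simp
qed

text \<open>One step of a discrete Gronwall argument: \<open>b\<close> and \<open>c\<close> stand
  for the velocity and position errors before the step, \<open>b'\<close> and \<open>c'\<close> for
  those after it, and \<open>\<omega>\<close> for the oscillation within the step.\<close>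

lemma symplectic_euler_error:
  fixes b c :: real
  assumes "0 \<le> b" "0 \<le> c" "0 \<le> h" "h \<le> 1" "0 \<le> L" "0 \<le> A" "0 \<le> \<omega>"
    and b': "b' \<le> b + h * (L * c) + h * \<omega>" and c': "c' \<le> c + h * (A * b') + h * (A * \<omega>)"
  shows "b' + c' \<le> (1 + h * (1 + L + A + A * L)) * (b + c) + h * ((1 + 2 * A) * \<omega>)"
proof -
  have hA: "0 \<le> h * A" and hh: "h * h \<le> h"
    using assms mult_left_le[of h h] by auto
  have "h * A * b' \<le> h * A * (b + h * (L * c) + h * \<omega>)"
    by (rule mult_left_mono[OF b' hA])
  also have "\<dots> = h * A * b + h * h * (A * (L * c + \<omega>))"
    by (simp add: algebra_simps)
  \<comment> \<open>The second-order contribution is absorbed by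
    \<open>h * h \<le> h\<close>.\<close>
  also have "\<dots> \<le> h * A * b + h * (A * (L * c + \<omega>))"
    using mult_right_mono[OF hh, of "A * (L * c + \<omega>)"] assms by auto
  finally have "b' + c' \<le> b + c + h * (L * c) + h * \<omega> + h * A * b
      + h * (A * (L * c + \<omega>)) + h * (A * \<omega>)"
    using b' c' by (simp add: algebra_simps)
  \<comment> \<open>Nonnegative terms are added so that \<open>b\<close> and \<open>c\<close>
    receive the same growth factor.\<close>
  also have "\<dots> \<le> b + c + h * (L * c) + h * \<omega> + h * A * b
      + h * (A * (L * c + \<omega>)) + h * (A * \<omega>) + h * (b + c + L * b + A * c + A * L * b)"
    using assms by auto
  also have "\<dots> = (1 + h * (1 + L + A + A * L)) * (b + c) + h * ((1 + 2 * A) * \<omega>)"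
    by (simp add: algebra_simps)
  finally show ?thesis .
qed

lemma norm_add_diff_le:
  assumes "norm p \<le> \<alpha>" "norm q \<le> \<beta>" "norm r \<le> \<gamma>"
  shows "norm (p + q - r) \<le> \<alpha> + \<beta> + \<gamma>"
  using norm_triangle_ineq4[of "p + q" r] norm_triangle_ineq[of p q] assms by linarith

text \<open>Consistency comes from uniform continuity of velocity and force along the trajectory,
  stability from a discrete Gronwall estimate. The Lipschitz constant is valid only in a ball, so
  the induction also has to keep the scheme within distance 1 of the trajectory.\<close>

lemma symplectic_euler_converges:
  fixes G :: "real \<Rightarrow> 'a::euclidean_space \<Rightarrow> 'a"
  assumes G: "lipschitz_force G" and xv: "newton_trajectory a G x v"
  shows "(\<lambda>n. symplectic_euler a G (1 / real (Suc n)) (Suc n) (x 0, v 0)) \<longlonglongrightarrow> (x 1, v 1)"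
proof (rule LIMSEQ_I)
  fix e :: real assume e: "e > 0"
  note cont = newton_trajectory_continuous_on[OF xv]
  note contF = force_along_continuous_on[OF G cont(1)]
  have dx: "\<And>t. t \<in> {0..1} \<Longrightarrow> (x has_vector_derivative a *\<^sub>R v t) (at t within {0..1})"
    and dv: "\<And>t. t \<in> {0..1} \<Longrightarrow> (v has_vector_derivative G t (x t)) (at t within {0..1})"
    using xv by (auto simp: newton_trajectory_def)
  obtain R where R: "\<And>t. t \<in> {0..1} \<Longrightarrow> norm (x t) \<le> R"
    using compact_imp_bounded[OF compact_continuous_image[OF cont(1) compact_Icc]]
    unfolding bounded_iff by blast
  obtain L where L: "\<And>t. t \<in> {0..1} \<Longrightarrow> L-lipschitz_on (cball 0 (R + 1)) (G t)"
    using G unfolding lipschitz_force_def by blast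
  have L0: "L \<ge> 0" using lipschitz_on_nonneg[OF L[of 0]] by simp
  define A where "A = \<bar>a\<bar>"
  define C where "C = 1 + L + A + A * L"
  define D where "D = 1 + 2 * A"
  have A0: "0 \<le> A" and C1: "C \<ge> 1" and D0: "D > 0"
    using L0 by (auto simp: A_def C_def D_def)
  \<comment> \<open>The final error bound is \<open>\<omega> * D * exp C\<close>. It is made equal
    to \<open>min 1 (e / 2)\<close>: the 1 confines the scheme to the tube, the \<open>e / 2\<close>
    gives the accuracy.\<close>
  define \<omega> where "\<omega> = min 1 (e / 2) / (D * exp C)"
  have w0: "\<omega> > 0" using e D0 by (simp add: \<omega>_def)
  have wD: "\<omega> * D * exp C = min 1 (e / 2)" using D0 by (simp add: \<omega>_def)
  obtain d1 where d1: "d1 > 0"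
    "\<And>s t. s \<in> {0..1} \<Longrightarrow> t \<in> {0..1} \<Longrightarrow> \<bar>s - t\<bar> < d1 \<Longrightarrow> dist (v s) (v t) < \<omega>"
    using uniform_modulus[OF cont(2) w0] by blast
  obtain d2 where d2: "d2 > 0"
    "\<And>s t. s \<in> {0..1} \<Longrightarrow> t \<in> {0..1} \<Longrightarrow> \<bar>s - t\<bar> < d2 \<Longrightarrow> dist (G s (x s)) (G t (x t)) < \<omega>"
    using uniform_modulus[OF contF w0] by blast
  have "min d1 d2 > 0" using d1 d2 by simp
  then obtain N where N: "1 / real (Suc N) < min d1 d2"
    using nat_approx_posE by blast
  show "\<exists>N. \<forall>n\<ge>N. norm (symplectic_euler a G (1 / real (Suc n)) (Suc n) (x 0, v 0) - (x 1, v 1)) < e"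
  proof (intro exI[of _ N] allI impI)
    fix n assume "n \<ge> N"
    define h where "h = 1 / real (Suc n)"
    have "h \<le> 1 / real (Suc N)" using \<open>n \<ge> N\<close> by (simp add: h_def frac_le)
    then have h: "0 < h" "h \<le> 1" "h < d1" "h < d2" using N by (auto simp: h_def)
    define X where "X k = fst (symplectic_euler a G h k (x 0, v 0))" for k
    define W where "W k = snd (symplectic_euler a G h k (x 0, v 0))" for k
    define s where "s k = norm (W k - v (k * h)) + norm (X k - x (k * h))" for k
    have WS: "W (Suc k) = W k + h *\<^sub>R G (k * h) (X k)" for k
      by (simp add: W_def X_def euler_step_def case_prod_beta)
    have XS: "X (Suc k) = X k + (h * a) *\<^sub>R W (Suc k)" for k
      by (simp add: W_def X_def euler_step_def case_prod_beta)
    have growth: "(1 + h * C) ^ k - 1 \<le> exp C" if "k \<le> Suc n" for k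
    proof -
      have "(1 + h * C) ^ k \<le> (1 + h * C) ^ Suc n"
        by (rule power_increasing) (use that h C1 in auto)
      also have "\<dots> \<le> exp (h * C) ^ Suc n"
        by (rule power_mono) (use h C1 in auto)
      also have "\<dots> = exp (real (Suc n) * (h * C))"
        by (rule exp_of_nat_mult[symmetric])
      also have "\<dots> = exp C" by (simp add: h_def)
      finally show ?thesis by simp
    qed
    \<comment> \<open>Closed form of the recursion
      \<open>s (Suc k) \<le> (1 + h * C) * s k + h * (D * \<omega>)\<close> with
      \<open>s 0 = 0\<close>.\<close>
    have bound: "s k \<le> \<omega> * D * ((1 + h * C) ^ k - 1)" if "k \<le> Suc n" for k
      using that
    proof (induction k)
      case 0
      then show ?case by (simp add: s_def X_def W_def)
    next
      case (Suc k)
      have Suc_kh: "real (Suc k) * h = k * h + h" by (simp add: algebra_simps)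
      have "real (Suc k) * h \<le> real (Suc n) * h"
        by (rule mult_right_mono) (use Suc.prems h in auto)
      then have kh1: "k * h + h \<le> 1"
        unfolding Suc_kh by (simp add: h_def)
      have kh0: "0 \<le> k * h" using h by simp
      have khI: "k * h \<in> {0..1}" using kh0 kh1 h by simp
      \<comment> \<open>The induction hypothesis bounds the position error by 1, so both positions
        lie in the ball on which \<open>L\<close> is valid.\<close>
      have "s k \<le> \<omega> * D * exp C"
        using Suc.IH Suc.prems growth[of k] w0 D0 by (smt (verit) Suc_leD mult_left_mono mult_pos_pos)
      then have "norm (X k - x (k * h)) \<le> 1"
        unfolding wD s_def by (smt (verit) norm_ge_zero)
      then have tube: "X k \<in> cball 0 (R + 1)" "x (k * h) \<in> cball 0 (R + 1)"
        using R[OF khI] norm_triangle_ineq[of "X k - x (k * h)" "x (k * h)"] by auto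
      have lip: "norm (G (k * h) (X k) - G (k * h) (x (k * h))) \<le> L * norm (X k - x (k * h))"
        using lipschitz_onD[OF L[OF khI] tube] by (simp add: dist_norm)
      have ev: "norm (v (k * h + h) - v (k * h) - ((k * h + h) - k * h) *\<^sub>R G (k * h) (x (k * h)))
          \<le> ((k * h + h) - k * h) * \<omega>"
      proof (rule increment_bound[OF dv])
        fix q assume q: "q \<in> {k * h..k * h + h}"
        show "norm (G q (x q) - G (k * h) (x (k * h))) \<le> \<omega>"
          using d2(2)[of q "k * h"] q order_trans[OF kh0, of q] kh1 h by (auto simp: dist_norm)
      qed (use kh0 kh1 h in auto)
      \<comment> \<open>The derivative of the position is frozen at the right end of the step,
        because the drift uses the updated velocity; that of the velocity was frozen at the left
        end.\<close>
      have ex: "norm (x (k * h + h) - x (k * h) - ((k * h + h) - k * h) *\<^sub>R (a *\<^sub>R v (k * h + h)))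
          \<le> ((k * h + h) - k * h) * (A * \<omega>)"
      proof (rule increment_bound[OF dx])
        fix q assume q: "q \<in> {k * h..k * h + h}"
        have "norm (v q - v (k * h + h)) \<le> \<omega>"
          using d1(2)[of q "k * h + h"] q order_trans[OF kh0, of q] kh1 h by (auto simp: dist_norm)
        then show "norm (a *\<^sub>R v q - a *\<^sub>R v (k * h + h)) \<le> A * \<omega>"
          by (simp add: A_def scaleR_diff_right[symmetric] mult_left_mono)
      qed (use kh0 kh1 h in auto)
      have "W (Suc k) - v (k * h + h) = (W k - v (k * h))
          + h *\<^sub>R (G (k * h) (X k) - G (k * h) (x (k * h)))
          - (v (k * h + h) - v (k * h) - h *\<^sub>R G (k * h) (x (k * h)))"
        by (simp add: WS algebra_simps)
      also have "norm \<dots> \<le> norm (W k - v (k * h)) + h * (L * norm (X k - x (k * h))) + h * \<omega>"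
        by (rule norm_add_diff_le) (use ev mult_left_mono[OF lip, of h] h in auto)
      finally have b: "norm (W (Suc k) - v (k * h + h))
          \<le> norm (W k - v (k * h)) + h * (L * norm (X k - x (k * h))) + h * \<omega>" .
      have "X (Suc k) - x (k * h + h) = (X k - x (k * h))
          + (h * a) *\<^sub>R (W (Suc k) - v (k * h + h))
          - (x (k * h + h) - x (k * h) - h *\<^sub>R (a *\<^sub>R v (k * h + h)))"
        by (simp add: XS algebra_simps)
      also have "norm \<dots> \<le> norm (X k - x (k * h))
          + h * (A * norm (W (Suc k) - v (k * h + h))) + h * (A * \<omega>)"
        by (rule norm_add_diff_le) (use ex h in \<open>auto simp: A_def abs_mult\<close>)
      finally have c: "norm (X (Suc k) - x (k * h + h)) \<le> norm (X k - x (k * h))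
          + h * (A * norm (W (Suc k) - v (k * h + h))) + h * (A * \<omega>)" .
      have "s (Suc k) \<le> (1 + h * C) * s k + h * (D * \<omega>)"
        unfolding s_def Suc_kh C_def D_def
        by (rule symplectic_euler_error[OF _ _ _ _ _ _ _ b c]) (use h L0 A0 w0 in auto)
      \<comment> \<open>Enlarging \<open>h\<close> to \<open>h * C\<close>, by
        \<open>C \<ge> 1\<close>, makes the geometric recursion close exactly.\<close>
      also have "\<dots> \<le> (1 + h * C) * (\<omega> * D * ((1 + h * C) ^ k - 1)) + h * C * (D * \<omega>)"
      proof (intro add_mono mult_left_mono mult_right_mono)
        show "h \<le> h * C" using h C1 by simp
      qed (use Suc h C1 D0 w0 in auto)
      also have "\<dots> = \<omega> * D * ((1 + h * C) ^ Suc k - 1)"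
        by (simp add: algebra_simps)
      finally show ?case .
    qed
    have "s (Suc n) \<le> \<omega> * D * exp C"
      using bound[of "Suc n"] growth[of "Suc n"] w0 D0 by (smt (verit) mult_left_mono mult_pos_pos order_refl)
    then have "s (Suc n) < e" using wD e by auto
    moreover have "real (Suc n) * h = 1" by (simp add: h_def)
    ultimately have "norm (X (Suc n) - x 1) + norm (W (Suc n) - v 1) < e"
      by (simp add: s_def)
    moreover have "symplectic_euler a G h (Suc n) (x 0, v 0) - (x 1, v 1)
        = (X (Suc n) - x 1, W (Suc n) - v 1)"
      by (simp add: X_def W_def prod_eq_iff)
    ultimately show "norm (symplectic_euler a G (1 / real (Suc n)) (Suc n) (x 0, v 0) - (x 1, v 1)) < e"
      unfolding h_def[symmetric]
      by (metis norm_Pair_le order_le_less_trans)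
  qed
qed

text \<open>Both end points are limits of the same scheme, which sees only the initial data.\<close>

lemma newton_trajectory_unique:
  fixes G :: "real \<Rightarrow> 'a::euclidean_space \<Rightarrow> 'a"
  assumes "lipschitz_force G" "newton_trajectory a G x v" "newton_trajectory a G x' v'"
    and "x 0 = x' 0" "v 0 = v' 0"
  shows "x 1 = x' 1 \<and> v 1 = v' 1"
  using LIMSEQ_unique[OF symplectic_euler_converges[OF assms(1,2)]
    symplectic_euler_converges[OF assms(1,3), folded assms(4,5)]] by simp

section \<open>Volume preservation by shears and Euler steps\<close>

text \<open>On each fibre a shear is a translation, so Tonelli reduces the claim to translation
  invariance. The two forms cover the kick and the drift.\<close>

lemma lborel_distr_shear:
  fixes c :: "'a::euclidean_space \<Rightarrow> 'b::euclidean_space"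
  assumes [measurable]: "c \<in> borel_measurable borel"
  shows "distr lborel borel (\<lambda>(x, v). (x, v + c x)) = lborel"
    and "distr lborel borel (\<lambda>(v, x). (v + c x, x)) = lborel"
proof -
  have trans: "(\<integral>\<^sup>+ v. h (v + c x) \<partial>lborel) = (\<integral>\<^sup>+ v. h v \<partial>lborel)"
    if [measurable]: "h \<in> borel_measurable borel" for h :: "'b \<Rightarrow> ennreal" and x
  proof -
    have "(\<integral>\<^sup>+ v. h v \<partial>lborel) = (\<integral>\<^sup>+ v. h v \<partial>distr lborel borel ((+) (c x)))"
      by (simp add: lborel_distr_plus)
    also have "\<dots> = (\<integral>\<^sup>+ v. h (v + c x) \<partial>lborel)"
      by (subst nn_integral_distr) (auto simp: add.commute)
    finally show ?thesis by simp
  qed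
  show "distr lborel borel (\<lambda>(x, v). (x, v + c x)) = lborel"
  proof (rule measure_eqI)
    fix B assume "B \<in> sets (distr lborel borel (\<lambda>(x, v). (x, v + c x)))"
    then have B[measurable]: "B \<in> sets (borel \<Otimes>\<^sub>M borel)"
      by (simp only: sets_distr borel_prod)
    have "emeasure (distr lborel borel (\<lambda>(x, v). (x, v + c x))) B
        = (\<integral>\<^sup>+ z. indicator B z \<partial>distr (lborel \<Otimes>\<^sub>M lborel) (borel \<Otimes>\<^sub>M borel) (\<lambda>(x, v). (x, v + c x)))"
      by (simp add: lborel_prod borel_prod B[unfolded borel_prod])
    also have "\<dots> = (\<integral>\<^sup>+ z. indicator B (case z of (x, v) \<Rightarrow> (x, v + c x)) \<partial>(lborel \<Otimes>\<^sub>M lborel))"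
      by (subst nn_integral_distr) auto
    also have "\<dots> = (\<integral>\<^sup>+ x. \<integral>\<^sup>+ v. indicator B (x, v + c x) \<partial>lborel \<partial>lborel)"
      by (subst lborel.nn_integral_fst[symmetric]) auto
    also have "\<dots> = (\<integral>\<^sup>+ x. \<integral>\<^sup>+ v. indicator B (x, v) \<partial>lborel \<partial>lborel)"
      by (subst trans) auto
    also have "\<dots> = emeasure lborel B"
      by (subst lborel.nn_integral_fst) (auto simp: lborel_prod B[unfolded borel_prod] intro!: borel_measurable_indicator B[unfolded borel_prod])
    finally show "emeasure (distr lborel borel (\<lambda>(x, v). (x, v + c x))) B = emeasure lborel B" .
  qed simp
  show "distr lborel borel (\<lambda>(v, x). (v + c x, x)) = lborel"
  proof (rule measure_eqI)
    fix B assume "B \<in> sets (distr lborel borel (\<lambda>(v, x). (v + c x, x)))"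
    then have B[measurable]: "B \<in> sets (borel \<Otimes>\<^sub>M borel)"
      by (simp only: sets_distr borel_prod)
    have "emeasure (distr lborel borel (\<lambda>(v, x). (v + c x, x))) B
        = (\<integral>\<^sup>+ z. indicator B z \<partial>distr (lborel \<Otimes>\<^sub>M lborel) (borel \<Otimes>\<^sub>M borel) (\<lambda>(v, x). (v + c x, x)))"
      by (simp add: lborel_prod borel_prod B[unfolded borel_prod])
    also have "\<dots> = (\<integral>\<^sup>+ z. indicator B (case z of (v, x) \<Rightarrow> (v + c x, x)) \<partial>(lborel \<Otimes>\<^sub>M lborel))"
      by (subst nn_integral_distr) auto
    also have "\<dots> = (\<integral>\<^sup>+ x. \<integral>\<^sup>+ v. indicator B (v + c x, x) \<partial>lborel \<partial>lborel)"
      by (subst lborel_pair.nn_integral_snd[symmetric]) auto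
    also have "\<dots> = (\<integral>\<^sup>+ x. \<integral>\<^sup>+ v. indicator B (v, x) \<partial>lborel \<partial>lborel)"
      by (subst trans) auto
    also have "\<dots> = emeasure lborel B"
      by (subst lborel_pair.nn_integral_snd) (auto simp: lborel_prod B[unfolded borel_prod] intro!: borel_measurable_indicator B[unfolded borel_prod])
    finally show "emeasure (distr lborel borel (\<lambda>(v, x). (v + c x, x))) B = emeasure lborel B" .
  qed simp
qed

lemma lborel_distr_comp:
  fixes S T :: "'a::euclidean_space \<Rightarrow> 'a"
  assumes "S \<in> borel_measurable borel" "distr lborel borel S = lborel"
    and "T \<in> borel_measurable borel" "distr lborel borel T = lborel"
  shows "T \<circ> S \<in> borel_measurable borel" "distr lborel borel (T \<circ> S) = lborel"
  using distr_distr[of T borel borel S lborel] assms by auto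

text \<open>The bound \<open>k * h \<le> 1\<close> keeps the evaluation times in the unit interval,
  where the force is continuous and the kicks are therefore measurable.\<close>

lemma symplectic_euler_preserves_lborel:
  fixes G :: "real \<Rightarrow> 'a::euclidean_space \<Rightarrow> 'a"
  assumes G: "lipschitz_force G" and h: "0 \<le> h" "k * h \<le> 1"
  shows "symplectic_euler a G h k \<in> borel_measurable borel \<and>
    distr lborel borel (symplectic_euler a G h k) = lborel"
  using h(2)
proof (induction k)
  case 0
  then show ?case by (simp add: id_def distr_id2)
next
  case (Suc k)
  have "k * h \<le> 1" "k * h \<in> {0..1}" using Suc.prems h(1) by (auto simp: algebra_simps)
  have [measurable]: "G (k * h) \<in> borel_measurable borel"
    by (intro borel_measurable_continuous_onI lipschitz_force_continuous_on G) fact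
  have [measurable]: "(\<lambda>(x, v). (x, v + h *\<^sub>R G (k * h) x)) \<in> borel_measurable borel"
    "(\<lambda>(x, v). (x + (h * a) *\<^sub>R v, v)) \<in> borel_measurable (borel :: ('a \<times> 'a) measure)"
    unfolding borel_prod[symmetric] by measurable
  have "euler_step a G h (k * h) \<in> borel_measurable borel"
    "distr lborel borel (euler_step a G h (k * h)) = lborel"
    unfolding euler_step_def by (intro lborel_distr_comp lborel_distr_shear; measurable)+
  then show ?case
    using Suc.IH[OF \<open>k * h \<le> 1\<close>] lborel_distr_comp by (auto simp del: o_apply)
qed

subsection \<open>Invariance of volume under the flow\<close>

text \<open>\<open>T\<close> is a pointwise limit of measurable volume-preserving maps. Fatou's
  lemma compares volumes in one direction; the other comes from applying this lemma to the reversed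
  system.\<close>

lemma time_one_map_measurable:
  fixes G :: "real \<Rightarrow> 'a::euclidean_space \<Rightarrow> 'a"
  assumes G: "lipschitz_force G"
    and T: "\<And>z. \<exists>x v. newton_trajectory a G x v \<and> (x 0, v 0) = z \<and> (x 1, v 1) = T z"
  shows "T \<in> borel_measurable borel"
    and "B \<in> sets borel \<Longrightarrow> emeasure lborel (T -` B) \<le> emeasure lborel B"
proof -
  define E where "E n = symplectic_euler a G (1 / real (Suc n)) (Suc n)" for n
  have lim: "(\<lambda>n. E n z) \<longlonglongrightarrow> T z" for z
  proof -
    obtain x v where xv: "newton_trajectory a G x v" "(x 0, v 0) = z" "(x 1, v 1) = T z"
      using T[of z] by blast
    show ?thesis
      using symplectic_euler_converges[OF G xv(1)] unfolding E_def xv(2,3) .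
  qed
  have "E n \<in> borel_measurable borel \<and> distr lborel borel (E n) = lborel" for n
    unfolding E_def by (rule symplectic_euler_preserves_lborel[OF G]) auto
  then have E[measurable]: "E n \<in> borel_measurable borel"
    and Ed: "distr lborel borel (E n) = lborel" for n
    by auto
  show T_meas[measurable]: "T \<in> borel_measurable borel"
    by (rule borel_measurable_LIMSEQ_metric[OF E lim])
  have open_le: "emeasure lborel (T -` U) \<le> emeasure lborel U" if U: "open U" for U
  proof -
    have [measurable]: "U \<in> sets borel" using U by simp
    \<comment> \<open>Openness enters here: if \<open>T z\<close> lies in \<open>U\<close>, then so
      does \<open>E n z\<close> for all large \<open>n\<close>.\<close>
    have ind: "indicator (T -` U) z \<le> liminf (\<lambda>n. indicator U (E n z) :: ennreal)" for z
    proof (cases "T z \<in> U")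
      case True
      then have "\<forall>\<^sub>F n in sequentially. E n z \<in> U"
        using lim[of z] U by (auto simp: tendsto_def)
      then have "\<forall>\<^sub>F n in sequentially. (1::ennreal) \<le> indicator U (E n z)"
        by eventually_elim simp
      then show ?thesis using True by (auto intro!: Liminf_bounded)
    qed simp
    have "emeasure lborel (T -` U) = (\<integral>\<^sup>+ z. indicator (T -` U) z \<partial>lborel)"
      using measurable_sets[OF T_meas, of U] by (subst nn_integral_indicator) auto
    also have "\<dots> \<le> (\<integral>\<^sup>+ z. liminf (\<lambda>n. indicator U (E n z)) \<partial>lborel)"
      by (intro nn_integral_mono ind)
    also have "\<dots> \<le> liminf (\<lambda>n. \<integral>\<^sup>+ z. indicator U (E n z) \<partial>lborel)"
      by (rule nn_integral_liminf) measurable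
    also have "(\<lambda>n. \<integral>\<^sup>+ z. indicator U (E n z) \<partial>lborel) = (\<lambda>n. emeasure lborel U)"
    proof
      fix n
      have "(\<integral>\<^sup>+ z. indicator U (E n z) \<partial>lborel)
          = (\<integral>\<^sup>+ z. indicator U z \<partial>distr lborel borel (E n))"
        by (subst nn_integral_distr) auto
      then show "(\<integral>\<^sup>+ z. indicator U (E n z) \<partial>lborel) = emeasure lborel U"
        by (simp add: Ed)
    qed
    finally show ?thesis by (simp add: Liminf_const)
  qed
  show "emeasure lborel (T -` B) \<le> emeasure lborel B" if B: "B \<in> sets borel"
  proof (rule ennreal_le_epsilon)
    fix e :: real assume "e > 0"
    obtain U where U: "open U" "B \<subseteq> U" "emeasure lborel (U - B) < e"
      using outer_regular_lborel[OF B \<open>e > 0\<close>] .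
    have "emeasure lborel (T -` B) \<le> emeasure lborel (T -` U)"
      using U measurable_sets[OF T_meas, of U] by (intro emeasure_mono) auto
    also have "\<dots> \<le> emeasure lborel U" by (rule open_le[OF U(1)])
    also have "\<dots> \<le> emeasure lborel B + emeasure lborel (U - B)"
      using emeasure_subadditive[of B lborel "U - B"] U B by (simp add: Un_absorb1)
    also have "\<dots> \<le> emeasure lborel B + e"
      using U(3) by (intro add_left_mono less_imp_le)
    finally show "emeasure lborel (T -` B) \<le> emeasure lborel B + e" .
  qed
qed

section \<open>Time reversal\<close>

lemma lipschitz_force_reverse:
  assumes "lipschitz_force G"
  shows "lipschitz_force (\<lambda>t x. - G (1 - t) x)"
  unfolding lipschitz_force_def
proof safe
  have "continuous_on ({0..1} \<times> UNIV) (\<lambda>p. - (\<lambda>(t, x). G t x) (1 - fst p, snd p))"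
    by (rule continuous_on_minus, rule continuous_on_compose2[of "{0..1} \<times> UNIV"])
      (use assms in \<open>auto simp: lipschitz_force_def intro!: continuous_intros\<close>)
  then show "continuous_on ({0..1} \<times> UNIV) (\<lambda>(t, x). - G (1 - t) x)"
    by (simp add: case_prod_beta)
next
  fix r :: real
  obtain L where "\<And>t. t \<in> {0..1} \<Longrightarrow> L-lipschitz_on (cball 0 r) (G t)"
    using assms unfolding lipschitz_force_def by blast
  then show "\<exists>L. \<forall>t\<in>{0..1}. L-lipschitz_on (cball 0 r) (\<lambda>x. - G (1 - t) x)"
    by (intro exI[of _ L]) (auto intro!: lipschitz_on_minus)
qed

text \<open>Both right-hand sides change sign. The velocity itself is not flipped; the sign in the
  position equation goes into \<open>a\<close>, so the reversed time-one map is literally the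
  inverse map on phase space.\<close>

lemma newton_trajectory_reverse:
  assumes "newton_trajectory a G x v"
  shows "newton_trajectory (- a) (\<lambda>t x. - G (1 - t) x) (\<lambda>t. x (1 - t)) (\<lambda>t. v (1 - t))"
proof -
  have rev: "((\<lambda>t. u (1 - t)) has_vector_derivative - d) (at t within {0..1})"
    if "(u has_vector_derivative d) (at (1 - t) within {0..1})" "t \<in> {0..1}"
    for u :: "real \<Rightarrow> 'a" and d t
  proof -
    have "((\<lambda>t. 1 - t) has_vector_derivative - 1) (at t within {0..1})"
      by (auto intro!: derivative_eq_intros)
    moreover have "(u has_vector_derivative d) (at (1 - t) within (\<lambda>t. 1 - t) ` {0..1})"
      by (rule has_vector_derivative_within_subset[OF that(1)]) auto
    ultimately have "(u \<circ> (\<lambda>t. 1 - t) has_vector_derivative (- 1) *\<^sub>R d) (at t within {0..1})"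
      by (rule vector_diff_chain_within)
    then show ?thesis by (simp add: o_def)
  qed
  show ?thesis
    using assms unfolding newton_trajectory_def
    by (auto intro!: rev[of _ "a *\<^sub>R v (1 - _)", simplified] rev)
qed

lemma newton_flow_preserves_lborel:
  fixes G :: "real \<Rightarrow> 'a::euclidean_space \<Rightarrow> 'a"
  assumes G: "lipschitz_force G"
    and fwd: "\<And>z. \<exists>x v. newton_trajectory a G x v \<and> (x 0, v 0) = z"
    and bwd: "\<And>z. \<exists>x v. newton_trajectory a G x v \<and> (x 1, v 1) = z"
  obtains T where "T \<in> borel_measurable borel" "distr lborel borel T = lborel"
    "\<And>x v. newton_trajectory a G x v \<Longrightarrow> T (x 0, v 0) = (x 1, v 1)"
proof -
  have "\<forall>z. \<exists>w. \<exists>x v. newton_trajectory a G x v \<and> (x 0, v 0) = z \<and> (x 1, v 1) = w"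
    using fwd by blast
  from choice[OF this] obtain T
    where T: "\<And>z. \<exists>x v. newton_trajectory a G x v \<and> (x 0, v 0) = z \<and> (x 1, v 1) = T z"
    by blast
  have "\<forall>z. \<exists>w. \<exists>x v. newton_trajectory a G x v \<and> (x 1, v 1) = z \<and> (x 0, v 0) = w"
    using bwd by blast
  from choice[OF this] obtain S
    where S: "\<And>z. \<exists>x v. newton_trajectory a G x v \<and> (x 1, v 1) = z \<and> (x 0, v 0) = S z"
    by blast
  \<comment> \<open>\<open>T\<close> was obtained by choosing a trajectory through each point; by
    uniqueness every trajectory obeys it.\<close>
  have T_eq: "T (x 0, v 0) = (x 1, v 1)" if xv: "newton_trajectory a G x v" for x v
  proof -
    obtain x' v' where "newton_trajectory a G x' v'" "(x' 0, v' 0) = (x 0, v 0)"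
      "(x' 1, v' 1) = T (x 0, v 0)"
      using T[of "(x 0, v 0)"] by blast
    then show ?thesis using newton_trajectory_unique[OF G xv, of x' v'] by auto
  qed
  have TS: "T (S z) = z" for z
    using S[of z] T_eq by metis
  note T_meas = time_one_map_measurable[OF G T]
  have S': "\<exists>x v. newton_trajectory (- a) (\<lambda>t x. - G (1 - t) x) x v \<and> (x 0, v 0) = z
      \<and> (x 1, v 1) = S z" for z
  proof -
    obtain x v where "newton_trajectory a G x v" "(x 1, v 1) = z" "(x 0, v 0) = S z"
      using S[of z] by blast
    then show ?thesis
      by (intro exI[of _ "\<lambda>t. x (1 - t)"] exI[of _ "\<lambda>t. v (1 - t)"])
        (auto intro: newton_trajectory_reverse)
  qed
  note S_meas = time_one_map_measurable[OF lipschitz_force_reverse[OF G] S']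
  have "distr lborel borel T = lborel"
  proof (rule measure_eqI)
    fix B assume "B \<in> sets (distr lborel borel T)"
    then have B: "B \<in> sets borel" by simp
    then have TB: "T -` B \<in> sets borel"
      using measurable_sets[OF T_meas(1)] by force
    have "emeasure lborel B = emeasure lborel (S -` (T -` B))"
      by (simp add: vimage_def TS)
    also have "\<dots> \<le> emeasure lborel (T -` B)"
      by (rule S_meas(2)[OF TB])
    finally have "emeasure lborel (T -` B) = emeasure lborel B"
      using T_meas(2)[OF B] by simp
    then show "emeasure (distr lborel borel T) B = emeasure lborel B"
      using T_meas(1) B by (simp add: emeasure_distr)
  qed simp
  then show thesis using that T_meas(1) T_eq by blast
qed

subsection \<open>Global existence for Lipschitz forces\<close>

lemma global_picard:
  fixes H :: "real \<Rightarrow> 'a::banach \<Rightarrow> 'a"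
  assumes cont: "continuous_on ({0..1} \<times> UNIV) (\<lambda>(t, z). H t z)"
    and lip: "\<And>t. t \<in> {0..1} \<Longrightarrow> L-lipschitz_on UNIV (H t)"
  shows "\<exists>z. z 0 = z0 \<and> (\<forall>t\<in>{0..1}. (z has_vector_derivative H t (z t)) (at t within {0..1}))"
proof -
  have L0: "L \<ge> 0" using lipschitz_on_nonneg[OF lip[of 0]] by simp
  \<comment> \<open>The unknown is \<open>w t = exp (- K * t) *\<^sub>R z t\<close>: this weight makes the integral operator a contraction
    on the whole unit interval at once.  Times are clamped to the interval by \<open>c\<close>.\<close>
  define K where "K = L + 1"
  have K: "K > 0" "L / K < 1" using L0 by (auto simp: K_def)
  define c :: "real \<Rightarrow> real" where "c t = max 0 (min 1 t)" for t
  have c: "c t \<in> {0..1}" "t \<in> {0..1} \<Longrightarrow> c t = t" for t by (auto simp: c_def)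
  define J where "J w s = integral {0..s} (\<lambda>r. H r (exp (K * r) *\<^sub>R w r))" for w s
  define P where "P w t = exp (- K * t) *\<^sub>R (z0 + J w t)" for w t
  have contH: "continuous_on {0..1} (\<lambda>r. H r (exp (K * r) *\<^sub>R w r))"
    if "continuous_on UNIV w" for w
  proof -
    have "continuous_on {0..1} (\<lambda>r. (\<lambda>(t, z). H t z) (r, exp (K * r) *\<^sub>R w r))"
      by (rule continuous_on_compose2[OF cont])
        (use that in \<open>auto intro!: continuous_intros intro: continuous_on_subset\<close>)
    then show ?thesis by simp
  qed
  have derJ: "(J w has_vector_derivative H t (exp (K * t) *\<^sub>R w t)) (at t within {0..1})"
    if "continuous_on UNIV w" "t \<in> {0..1}" for w t
    using integral_has_vector_derivative[OF contH[OF that(1)] that(2)] by (simp add: J_def[abs_def])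
  have contP: "continuous_on {0..1} (P w)" if "continuous_on UNIV w" for w
  proof -
    have "continuous_on {0..1} (J w)"
      unfolding continuous_on_eq_continuous_within
      by (intro ballI has_vector_derivative_continuous[OF derJ[OF that]])
    then show ?thesis
      unfolding P_def[abs_def] by (intro continuous_intros)
  qed
  have Pc: "(\<lambda>t. P w (c t)) \<in> bcontfun" if "continuous_on UNIV w" for w
  proof -
    have "continuous_on UNIV (\<lambda>t. P w (c t))"
      by (rule continuous_on_compose2[OF contP[OF that]])
        (use c in \<open>auto simp: c_def intro!: continuous_intros\<close>)
    moreover have "bounded (range (\<lambda>t. P w (c t)))"
      by (rule bounded_subset[OF compact_imp_bounded[OF
              compact_continuous_image[OF contP[OF that] compact_Icc]]])
        (use c in auto)
    ultimately show ?thesis by (simp add: bcontfun_def)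
  qed
  \<comment> \<open>Clamping makes the image bounded on the whole line, so the operator acts on the
    complete space of bounded continuous functions and Banach's theorem applies.\<close>
  define \<Theta> :: "(real \<Rightarrow>\<^sub>C 'a) \<Rightarrow> (real \<Rightarrow>\<^sub>C 'a)"
    where "\<Theta> w = Bcontfun (\<lambda>t. P (apply_bcontfun w) (c t))" for w
  have \<Theta>: "apply_bcontfun (\<Theta> w) t = P (apply_bcontfun w) (c t)" for w t
    unfolding \<Theta>_def by (subst Bcontfun_inverse) (auto intro: Pc)
  have contr: "dist (\<Theta> w1) (\<Theta> w2) \<le> (L / K) * dist w1 w2" for w1 w2
  proof (rule dist_bound)
    fix t
    define s where "s = c t"
    have s: "s \<in> {0..1}" using c by (simp add: s_def)
    define d where "d = dist w1 w2"
    have int: "(\<lambda>r. H r (exp (K * r) *\<^sub>R apply_bcontfun w r)) integrable_on {0..s}" for w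
      by (rule integrable_continuous_real)
        (use s in \<open>auto intro!: continuous_on_subset[OF contH]\<close>)
    \<comment> \<open>Integrating the weighted Lipschitz bound yields
      \<open>L / K * exp (K * s)\<close>; the outer weight \<open>exp (- K * s)\<close> cancels the
      exponential and leaves the contraction constant \<open>L / K\<close>.\<close>
    have ftc: "((\<lambda>r. L * (exp (K * r) * d)) has_integral
        (L / K * exp (K * s) * d - L / K * exp (K * 0) * d)) {0..s}"
      by (rule fundamental_theorem_of_calculus)
        (use s K in \<open>auto intro!: derivative_eq_intros
          simp: has_real_derivative_iff_has_vector_derivative[symmetric]\<close>)
    have "norm (J w1 s - J w2 s) = norm (integral {0..s} (\<lambda>r. H r (exp (K * r) *\<^sub>R apply_bcontfun w1 r)
        - H r (exp (K * r) *\<^sub>R apply_bcontfun w2 r)))"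
      unfolding J_def by (subst integral_diff[OF int int]) simp
    also have "\<dots> \<le> integral {0..s} (\<lambda>r. L * (exp (K * r) * d))"
    proof (rule integral_norm_bound_integral)
      show "(\<lambda>r. L * (exp (K * r) * d)) integrable_on {0..s}"
        using ftc by blast
      fix r assume r: "r \<in> {0..s}"
      have "norm (H r (exp (K * r) *\<^sub>R apply_bcontfun w1 r) - H r (exp (K * r) *\<^sub>R apply_bcontfun w2 r))
          \<le> L * dist (exp (K * r) *\<^sub>R apply_bcontfun w1 r) (exp (K * r) *\<^sub>R apply_bcontfun w2 r)"
        using lipschitz_onD[OF lip] r s by (force simp: dist_norm)
      also have "dist (exp (K * r) *\<^sub>R apply_bcontfun w1 r) (exp (K * r) *\<^sub>R apply_bcontfun w2 r)
          = exp (K * r) * dist (apply_bcontfun w1 r) (apply_bcontfun w2 r)"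
        by (simp add: dist_norm scaleR_diff_right[symmetric])
      also have "L * (exp (K * r) * dist (apply_bcontfun w1 r) (apply_bcontfun w2 r))
          \<le> L * (exp (K * r) * d)"
        unfolding d_def by (intro mult_left_mono dist_bounded L0) auto
      finally show "norm (H r (exp (K * r) *\<^sub>R apply_bcontfun w1 r)
          - H r (exp (K * r) *\<^sub>R apply_bcontfun w2 r)) \<le> L * (exp (K * r) * d)" .
    qed (intro integrable_diff int)
    also have "\<dots> = L / K * exp (K * s) * d - L / K * d"
      using integral_unique[OF ftc] by simp
    also have "\<dots> \<le> L / K * exp (K * s) * d"
      using L0 K by (simp add: d_def)
    finally have J: "norm (J w1 s - J w2 s) \<le> L / K * exp (K * s) * d" .
    have "dist (\<Theta> w1 t) (\<Theta> w2 t) = exp (- K * s) * norm (J w1 s - J w2 s)"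
      by (simp add: \<Theta> P_def s_def dist_norm scaleR_diff_right[symmetric])
    also have "\<dots> \<le> exp (- K * s) * (L / K * exp (K * s) * d)"
      by (intro mult_left_mono J) auto
    also have "\<dots> = L / K * d" by (simp add: exp_minus field_simps)
    finally show "dist (\<Theta> w1 t) (\<Theta> w2 t) \<le> L / K * dist w1 w2" by (simp add: d_def)
  qed
  obtain w where w: "\<Theta> w = w"
    using banach_fix_type[of "L / K" \<Theta>] contr L0 K by auto
  \<comment> \<open>Undoing the weight: on the unit interval the fixed-point equation reads
    \<open>exp (K * t) *\<^sub>R w t = z0 + J w t\<close>.\<close>
  define z where "z t = z0 + J w t" for t
  have zw: "exp (K * t) *\<^sub>R w t = z t" if "t \<in> {0..1}" for t
    using \<Theta>[of w t] c(2)[OF that] by (simp add: w P_def z_def exp_minus)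
  have "(z has_vector_derivative H t (z t)) (at t within {0..1})" if "t \<in> {0..1}" for t
    unfolding z_def[abs_def] using derJ[of w t] that zw[OF that]
    by (auto intro!: derivative_eq_intros simp: z_def)
  moreover have "z 0 = z0" by (simp add: z_def J_def)
  ultimately show ?thesis by blast
qed

text \<open>The second-order equation is solved as a first-order system on pairs, with Lipschitz
  constant \<open>\<bar>a\<bar> + L\<close>. On the torus this supplies the global flow.\<close>

lemma newton_trajectory_exists:
  fixes G :: "real \<Rightarrow> 'a::euclidean_space \<Rightarrow> 'a"
  assumes G: "lipschitz_force G" and lip: "\<And>t. t \<in> {0..1} \<Longrightarrow> L-lipschitz_on UNIV (G t)"
  shows "\<exists>x v. newton_trajectory a G x v \<and> (x 0, v 0) = z"
proof -
  define H where "H t w = (a *\<^sub>R snd w, G t (fst w))" for t and w :: "'a \<times> 'a"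
  have "continuous_on ({0..1} \<times> UNIV) (\<lambda>p. (\<lambda>(t, x). G t x) (fst p, fst (snd p :: 'a \<times> 'a)))"
    by (rule continuous_on_compose2[of "{0..1} \<times> UNIV"])
      (use G in \<open>auto simp: lipschitz_force_def intro!: continuous_intros\<close>)
  then have "continuous_on ({0..1} \<times> UNIV) (\<lambda>(t, w). H t w)"
    by (auto simp: H_def case_prod_beta intro!: continuous_intros)
  moreover have "(\<bar>a\<bar> + L)-lipschitz_on UNIV (H t)" if t: "t \<in> {0..1}" for t
  proof (rule lipschitz_onI)
    show L0: "0 \<le> \<bar>a\<bar> + L" using lipschitz_on_nonneg[OF lip[OF t]] by simp
    fix p q :: "'a \<times> 'a"
    have "dist (H t p) (H t q) \<le> norm (a *\<^sub>R (snd p - snd q)) + norm (G t (fst p) - G t (fst q))"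
      using norm_Pair_le[of "a *\<^sub>R (snd p - snd q)" "G t (fst p) - G t (fst q)"]
      by (simp add: H_def dist_norm scaleR_diff_right)
    also have "norm (G t (fst p) - G t (fst q)) \<le> L * norm (fst p - fst q)"
      using lipschitz_onD[OF lip[OF t], of "fst p" "fst q"] by (simp add: dist_norm)
    also have "norm (a *\<^sub>R (snd p - snd q)) + L * norm (fst p - fst q)
        \<le> \<bar>a\<bar> * dist p q + L * dist p q"
      using lipschitz_on_nonneg[OF lip[OF t]] dist_fst_le[of p q] dist_snd_le[of p q]
      by (auto simp: dist_norm intro!: add_mono mult_left_mono)
    finally show "dist (H t p) (H t q) \<le> (\<bar>a\<bar> + L) * dist p q"
      by (simp add: algebra_simps)
  qed
  ultimately obtain w where w: "w 0 = z"
    "\<And>t. t \<in> {0..1} \<Longrightarrow> (w has_vector_derivative H t (w t)) (at t within {0..1})"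
    using global_picard[of H "\<bar>a\<bar> + L" z] by blast
  have "newton_trajectory a G (\<lambda>t. fst (w t)) (\<lambda>t. snd (w t))"
    unfolding newton_trajectory_def
    using bounded_linear.has_vector_derivative[OF bounded_linear_fst w(2)]
      bounded_linear.has_vector_derivative[OF bounded_linear_snd w(2)]
    by (simp add: H_def)
  then show ?thesis using w(1) by force
qed

subsection \<open>Fundamental domains\<close>

text \<open>Split \<open>C\<close> according to the period \<open>k\<close> that brings
  \<open>T z\<close> back into \<open>C\<close>, and translate each piece by \<open>k\<close>. Since
  \<open>T\<close> commutes with periods, the pieces reassemble to the preimage of \<open>C\<close>
  under \<open>T\<close>, and measure preservation finishes.\<close>

lemma nn_integral_fundamental_domain:
  fixes P C :: "'a::euclidean_space set" and h :: "'a \<Rightarrow> ennreal"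
  assumes P: "countable P" "\<And>k. k \<in> P \<Longrightarrow> - k \<in> P"
    and C[measurable]: "C \<in> sets borel" and dom: "\<And>z. \<exists>!k. k \<in> P \<and> z - k \<in> C"
    and T[measurable]: "T \<in> borel_measurable borel" and TM: "distr lborel borel T = lborel"
    and TP: "\<And>k z. k \<in> P \<Longrightarrow> T (z + k) = T z + k"
    and h[measurable]: "h \<in> borel_measurable borel" and hP: "\<And>k z. k \<in> P \<Longrightarrow> h (z + k) = h z"
  shows "(\<integral>\<^sup>+ z. h (T z) * indicator C z \<partial>lborel) = (\<integral>\<^sup>+ z. h z * indicator C z \<partial>lborel)"
proof -
  \<comment> \<open>Exactly one translate of \<open>C\<close> contains a given point, so the
    indicators of the translates sum to 1.\<close>
  have one: "(\<integral>\<^sup>+ k. indicator C (z - k) \<partial>count_space P) = 1" for z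
  proof -
    obtain k0 where k0: "k0 \<in> P" "\<And>k. k \<in> P \<Longrightarrow> z - k \<in> C \<longleftrightarrow> k = k0"
      using dom[of z] by metis
    have "(\<integral>\<^sup>+ k. indicator C (z - k) \<partial>count_space P) = (\<integral>\<^sup>+ k. indicator {k0} k \<partial>count_space P)"
      by (rule nn_integral_cong) (auto simp: indicator_def k0)
    also have "\<dots> = 1" using k0 by (subst nn_integral_indicator) auto
    finally show ?thesis .
  qed
  have one': "(\<integral>\<^sup>+ k. indicator C (z + k) \<partial>count_space P) = 1" for z
  proof -
    have "bij_betw uminus P P"
      by (rule bij_betwI[where g = uminus]) (use P(2) in auto)
    from nn_integral_bij_count_space[OF this, of "\<lambda>k. indicator C (z - k)"]
    show ?thesis by (simp add: one)
  qed
  have trans: "(\<integral>\<^sup>+ z. F z \<partial>lborel) = (\<integral>\<^sup>+ z. F (z + k) \<partial>lborel)"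
    if [measurable]: "F \<in> borel_measurable borel" for F :: "'a \<Rightarrow> ennreal" and k
  proof -
    have "(\<integral>\<^sup>+ z. F z \<partial>lborel) = (\<integral>\<^sup>+ z. F z \<partial>distr lborel borel ((+) k))"
      by (simp add: lborel_distr_plus)
    also have "\<dots> = (\<integral>\<^sup>+ z. F (z + k) \<partial>lborel)"
      by (subst nn_integral_distr) (auto simp: add.commute)
    finally show ?thesis .
  qed
  have "(\<integral>\<^sup>+ z. h (T z) * indicator C z \<partial>lborel)
      = (\<integral>\<^sup>+ z. h (T z) * indicator C z * (\<integral>\<^sup>+ k. indicator C (T z - k) \<partial>count_space P) \<partial>lborel)"
    by (simp add: one)
  also have "\<dots> = (\<integral>\<^sup>+ z. \<integral>\<^sup>+ k. h (T z) * indicator C z * indicator C (T z - k) \<partial>count_space P \<partial>lborel)"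
    by (subst nn_integral_cmult) auto
  also have "\<dots> = (\<integral>\<^sup>+ k. \<integral>\<^sup>+ z. h (T z) * indicator C z * indicator C (T z - k) \<partial>lborel \<partial>count_space P)"
    by (rule nn_integral_count_space_nn_integral[OF P(1)]) measurable
  \<comment> \<open>The shift by \<open>k\<close> moves the restriction to \<open>C\<close> from
    \<open>z\<close> to \<open>T z\<close>; the sum over periods now falls on
    \<open>z + k\<close>.\<close>
  also have "\<dots> = (\<integral>\<^sup>+ k. \<integral>\<^sup>+ z. h (T z) * indicator C (T z) * indicator C (z + k) \<partial>lborel \<partial>count_space P)"
  proof (rule nn_integral_cong)
    fix k assume "k \<in> space (count_space P)"
    then have k: "k \<in> P" by simp
    have "(\<integral>\<^sup>+ z. h (T z) * indicator C z * indicator C (T z - k) \<partial>lborel)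
        = (\<integral>\<^sup>+ z. h (T (z + k)) * indicator C (z + k) * indicator C (T (z + k) - k) \<partial>lborel)"
      by (rule trans) measurable
    then show "(\<integral>\<^sup>+ z. h (T z) * indicator C z * indicator C (T z - k) \<partial>lborel)
        = (\<integral>\<^sup>+ z. h (T z) * indicator C (T z) * indicator C (z + k) \<partial>lborel)"
      by (simp add: TP hP k mult_ac)
  qed
  also have "\<dots> = (\<integral>\<^sup>+ z. \<integral>\<^sup>+ k. h (T z) * indicator C (T z) * indicator C (z + k) \<partial>count_space P \<partial>lborel)"
    by (rule nn_integral_count_space_nn_integral[OF P(1), symmetric]) measurable
  also have "\<dots> = (\<integral>\<^sup>+ z. h (T z) * indicator C (T z) \<partial>lborel)"
    by (subst nn_integral_cmult) (auto simp: one')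
  also have "\<dots> = (\<integral>\<^sup>+ z. h z * indicator C z \<partial>distr lborel borel T)"
    by (subst nn_integral_distr) auto
  finally show ?thesis by (simp add: TM)
qed

subsection \<open>The Liouville equation\<close>

text \<open>\<open>grad\<close> is a definite description, so a representing vector must first be
  exhibited; it is the adjoint of \<open>D\<close> applied to 1.\<close>

lemma has_derivative_grad:
  fixes h :: "'a::euclidean_space \<Rightarrow> real"
  assumes "(h has_derivative D) (at x)"
  shows "D w = w \<bullet> grad h x"
proof -
  have D: "D w = w \<bullet> adjoint D 1" for w
    using adjoint_works[OF has_derivative_linear[OF assms], of w 1] by simp
  then have "GDERIV h x :> adjoint D 1"
    using assms unfolding gderiv_def by (metis (no_types, lifting) ext)
  then show ?thesis using grad_eq D by metis
qed

text \<open>The gradient predicates at \<open>x + k\<close> and at \<open>x\<close> are equivalent,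
  so the two definite descriptions coincide whether or not a gradient exists.\<close>

lemma grad_translate:
  assumes "\<And>y. h (y + k) = h y"
  shows "grad h (x + k) = grad h x"
proof -
  have "GDERIV h (x + k) :> D \<longleftrightarrow> GDERIV h x :> D" for D
  proof
    assume "GDERIV h (x + k) :> D"
    then have "(h \<circ> (\<lambda>y. y + k) has_derivative (\<lambda>w. w \<bullet> D) \<circ> (\<lambda>w. w)) (at x)"
      unfolding gderiv_def by (intro diff_chain_at) (auto intro!: derivative_eq_intros)
    then show "GDERIV h x :> D" by (simp add: gderiv_def o_def assms)
  next
    have *: "h (y - k) = h y" for y using assms[of "y - k"] by simp
    assume "GDERIV h x :> D"
    then have "(h \<circ> (\<lambda>y. y - k) has_derivative (\<lambda>w. w \<bullet> D) \<circ> (\<lambda>w. w)) (at (x + k))"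
      unfolding gderiv_def by (intro diff_chain_at) (auto intro!: derivative_eq_intros)
    then show "GDERIV h (x + k) :> D" by (simp add: gderiv_def o_def *)
  qed
  then show ?thesis by (simp add: grad_def)
qed

lemma hamiltonian_trajectory_iff_newton:
  "hamiltonian_trajectory V x v \<longleftrightarrow> newton_trajectory 1 (\<lambda>t x. - grad (\<lambda>y. V y t) x) x v"
  by (simp add: hamiltonian_trajectory_def newton_trajectory_def)

text \<open>Compactness of the ball and of the time interval, with continuity in time, turns the
  local Lipschitz condition into one constant per ball.\<close>

lemma potential_lipschitz_force:
  assumes "potential X V"
  shows "lipschitz_force (\<lambda>t x. - grad (\<lambda>y. V y t) x)"
proof -
  let ?F = "\<lambda>t x. - grad (\<lambda>y. V y t) x"
  have cont: "continuous_on ({0..1} \<times> UNIV) (\<lambda>(t, x). ?F t x)"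
    using assms continuous_on_minus unfolding potential_def by (fastforce simp: case_prod_beta)
  have ll: "local_lipschitz {0..1} UNIV ?F"
    using assms by (simp add: potential_def local_lipschitz_minus)
  have "\<exists>L. \<forall>t\<in>{0..1}. L-lipschitz_on (cball 0 r) (?F t)" for r
  proof -
    have "continuous_on {0..1} (\<lambda>t. ?F t x)" for x
    proof -
      have "continuous_on {0..1} (\<lambda>t. (\<lambda>(t, x). ?F t x) (t, x))"
        by (rule continuous_on_compose2[OF cont]) (auto intro!: continuous_intros)
      then show ?thesis by simp
    qed
    then obtain L where "\<And>t. t \<in> {0..1} \<Longrightarrow> L-lipschitz_on (cball 0 r) (?F t)"
      using local_lipschitz_compact_implies_lipschitz[OF
          local_lipschitz_subset[OF ll order_refl subset_UNIV] compact_cball compact_Icc]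
      by blast
    then show ?thesis by blast
  qed
  then show ?thesis using cont by (simp add: lipschitz_force_def)
qed

text \<open>Method of characteristics. The derivative along the trajectory vanishes at interior
  times, and continuity up to the end times lets the mean value theorem compare the end
  values.\<close>

lemma liouville_constant_along_trajectory:
  assumes \<rho>: "liouville_solution X V \<rho>" and xv: "hamiltonian_trajectory V x v"
  shows "\<rho> (x 1) (v 1) 1 = \<rho> (x 0) (v 0) 0"
proof -
  let ?r = "\<lambda>(x, v, t). \<rho> x v t"
  have dx: "\<And>t. t \<in> {0..1} \<Longrightarrow> (x has_vector_derivative v t) (at t within {0..1})"
    and dv: "\<And>t. t \<in> {0..1} \<Longrightarrow>
      (v has_vector_derivative - grad (\<lambda>y. V y t) (x t)) (at t within {0..1})"
    using xv by (auto simp: hamiltonian_trajectory_def)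
  have c: "continuous_on {0..1} x" "continuous_on {0..1} v"
    using newton_trajectory_continuous_on xv[unfolded hamiltonian_trajectory_iff_newton] by blast+
  show ?thesis
  proof (rule DERIV_isconst_end[of 0 1 "\<lambda>t. \<rho> (x t) (v t) t", simplified])
    have "continuous_on {0..1} (\<lambda>t. ?r (x t, v t, t))"
      by (rule continuous_on_compose2[of "UNIV \<times> UNIV \<times> {0..1}"])
        (use \<rho> c in \<open>auto simp: liouville_solution_def intro!: continuous_intros\<close>)
    then show "continuous_on {0..1} (\<lambda>t. \<rho> (x t) (v t) t)" by simp
  next
    fix t :: real assume t: "0 < t" "t < 1"
    have at: "at t within {0..1} = at t" using t by (simp add: at_within_Icc_at)
    define F where "F = grad (\<lambda>y. V y t) (x t)"
    have dx': "(x has_vector_derivative v t) (at t)" and dv': "(v has_vector_derivative - F) (at t)"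
      using dx[of t] dv[of t] t by (simp_all add: at F_def)
    have "?r differentiable (at (x t, v t, t))"
      and eq: "deriv (\<lambda>s. \<rho> (x t) (v t) s) t + v t \<bullet> grad (\<lambda>y. \<rho> y (v t) t) (x t)
          - F \<bullet> grad (\<lambda>w. \<rho> (x t) w t) (v t) = 0"
      using \<rho> t by (auto simp: liouville_solution_def F_def)
    then obtain D where D: "(?r has_derivative D) (at (x t, v t, t))"
      by (auto simp: differentiable_def)
    interpret D: bounded_linear D using has_derivative_bounded_linear[OF D] .
    \<comment> \<open>The total derivative \<open>D\<close> is restricted to the time, position and
      velocity directions in turn, to identify it with the partial derivatives in the
      equation.\<close>
    have "(?r \<circ> (\<lambda>s. (x t, v t, s)) has_derivative D \<circ> (\<lambda>s. (0, 0, s))) (at t)"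
      by (rule diff_chain_at) (auto intro!: derivative_eq_intros D simp: zero_prod_def)
    then have "((\<lambda>s. \<rho> (x t) (v t) s) has_derivative (\<lambda>s. D (0, 0, s))) (at t)"
      by (simp add: o_def)
    moreover have "(\<lambda>s. D (0, 0, s)) = (*) (D (0, 0, 1))"
    proof
      fix s :: real
      show "D (0, 0, s) = D (0, 0, 1) * s" using D.scaleR[of s "(0, 0, 1)"] by simp
    qed
    ultimately have "((\<lambda>s. \<rho> (x t) (v t) s) has_real_derivative D (0, 0, 1)) (at t)"
      by (simp add: has_field_derivative_def)
    then have t_part: "D (0, 0, 1) = deriv (\<lambda>s. \<rho> (x t) (v t) s) t"
      by (simp add: DERIV_imp_deriv)
    have "(?r \<circ> (\<lambda>y. (y, v t, t)) has_derivative D \<circ> (\<lambda>w. (w, 0, 0))) (at (x t))"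
      by (rule diff_chain_at) (auto intro!: derivative_eq_intros D simp: zero_prod_def)
    then have "((\<lambda>y. \<rho> y (v t) t) has_derivative (\<lambda>w. D (w, 0, 0))) (at (x t))"
      by (simp add: o_def)
    note x_part = has_derivative_grad[OF this]
    have "(?r \<circ> (\<lambda>w. (x t, w, t)) has_derivative D \<circ> (\<lambda>w. (0, w, 0))) (at (v t))"
      by (rule diff_chain_at) (auto intro!: derivative_eq_intros D simp: zero_prod_def)
    then have "((\<lambda>w. \<rho> (x t) w t) has_derivative (\<lambda>w. D (0, w, 0))) (at (v t))"
      by (simp add: o_def)
    note v_part = has_derivative_grad[OF this]
    \<comment> \<open>The Liouville equation says precisely that \<open>D\<close> kills the
      direction of the trajectory in extended phase space.\<close>
    have "D (v t, - F, 1) = D (v t, 0, 0) + D (0, - F, 0) + D (0, 0, 1)"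
      by (simp add: D.add[symmetric])
    also have "\<dots> = 0" using eq by (simp add: x_part v_part t_part)
    finally have D0: "D (v t, - F, 1) = 0" .
    have "(?r \<circ> (\<lambda>s. (x s, v s, s)) has_derivative D \<circ> (\<lambda>s. (s *\<^sub>R v t, s *\<^sub>R - F, s))) (at t)"
      by (rule diff_chain_at) (use dx' dv' D in
        \<open>auto simp: has_vector_derivative_def intro!: derivative_eq_intros\<close>)
    moreover have "D \<circ> (\<lambda>s. (s *\<^sub>R v t, s *\<^sub>R - F, s)) = (\<lambda>s. 0)"
    proof
      fix s :: real
      show "(D \<circ> (\<lambda>s. (s *\<^sub>R v t, s *\<^sub>R - F, s))) s = 0"
        using D.scaleR[of s "(v t, - F, 1)"] by (simp add: D0)
    qed
    ultimately show "((\<lambda>s. \<rho> (x s) (v s) s) has_real_derivative 0) (at t)"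
      by (simp add: o_def has_field_derivative_def mult_zero_left[abs_def])
  qed
qed

section \<open>The period lattice and periodic forces\<close>

lemma countable_periods: "countable (periods X :: (real^'n) set)"
proof (cases X)
  case Torus
  have "periods Torus \<subseteq> range (\<lambda>k. \<chi> i. of_int (k i) :: real^'n)"
  proof
    fix k :: "real^'n" assume "k \<in> periods Torus"
    then have "k = (\<chi> i. of_int \<lfloor>k $ i\<rfloor>)" by (simp add: vec_eq_iff)
    then show "k \<in> range (\<lambda>k. \<chi> i. of_int (k i) :: real^'n)" by (rule range_eqI[where x = "\<lambda>i. \<lfloor>k $ i\<rfloor>"])
  qed
  then show ?thesis unfolding Torus by (rule countable_subset) simp
qed simp

lemma uminus_periods: "k \<in> periods X \<Longrightarrow> - k \<in> periods X"
  by (cases X) auto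

text \<open>On the torus the period is the componentwise floor of \<open>x\<close>.\<close>

lemma ex1_period_cell:
  fixes x :: "real^'n"
  shows "\<exists>!k. k \<in> periods X \<and> x - k \<in> cell X"
proof (cases X)
  case Torus
  show ?thesis
  proof (rule ex1I[of _ "\<chi> i. of_int \<lfloor>x $ i\<rfloor>"])
    show "(\<chi> i. of_int \<lfloor>x $ i\<rfloor>) \<in> periods X \<and> x - (\<chi> i. of_int \<lfloor>x $ i\<rfloor>) \<in> cell X"
      using Torus by auto linarith
    fix k assume k: "k \<in> periods X \<and> x - k \<in> cell X"
    show "k = (\<chi> i. of_int \<lfloor>x $ i\<rfloor>)"
    proof (rule vec_eq_iff[THEN iffD2], rule allI)
      fix i
      have "k $ i \<in> \<int>" using k Torus by simp
      then obtain m where m: "k $ i = of_int m" by (auto elim: Ints_cases)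
      have "0 \<le> x $ i - of_int m" "x $ i - of_int m < 1"
        using k Torus unfolding m[symmetric] by auto
      then have "\<lfloor>x $ i\<rfloor> = m" by linarith
      then show "k $ i = (\<chi> i. of_int \<lfloor>x $ i\<rfloor>) $ i" using m by simp
    qed
  qed
qed simp

lemma borel_cell: "(cell X :: (real^'n) set) \<in> sets borel"
proof (cases X)
  case Torus
  have "cell Torus = (\<Inter>i. {x::real^'n. 0 \<le> x $ i} \<inter> {x. x $ i < 1})" by auto
  also have "\<dots> \<in> sets borel"
    by (intro sets.countable_INT'' sets.Int borel_closed borel_open closed_Collect_le
        open_Collect_less continuous_intros) auto
  finally show ?thesis using Torus by simp
qed simp

lemma bounded_cell_Torus: "(cell Torus :: (real^'n) set) \<subseteq> cball 0 (real CARD('n))"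
proof
  fix x :: "real^'n" assume x: "x \<in> cell Torus"
  have "norm x \<le> (\<Sum>i\<in>UNIV. \<bar>x $ i\<bar>)" by (rule norm_le_l1_cart)
  also have "\<dots> \<le> (\<Sum>i\<in>(UNIV :: 'n set). 1)"
    by (rule sum_mono) (use x in \<open>auto simp: less_imp_le\<close>)
  finally show "x \<in> cball 0 (real CARD('n))" by simp
qed

text \<open>A Lipschitz bound on a neighbourhood of one cell spreads to the whole space: close
  points are moved by a common period, distant points are moved into the cell separately. Here
  \<open>r\<close> bounds the norm on the cell.\<close>

lemma periodic_force_lipschitz:
  fixes G :: "real \<Rightarrow> real^'n \<Rightarrow> real^'n"
  assumes G: "lipschitz_force G" and per: "\<And>t. t \<in> {0..1} \<Longrightarrow> config_invariant Torus (G t)"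
  obtains L where "\<And>t. t \<in> {0..1} \<Longrightarrow> L-lipschitz_on UNIV (G t)"
proof -
  define r where "r = real CARD('n)"
  obtain L where L: "\<And>t. t \<in> {0..1} \<Longrightarrow> L-lipschitz_on (cball 0 (r + 1)) (G t)"
    using G unfolding lipschitz_force_def by blast
  have L0: "L \<ge> 0" using lipschitz_on_nonneg[OF L[of 0]] by simp
  have "(L * (1 + 2 * r))-lipschitz_on UNIV (G t)" if t: "t \<in> {0..1}" for t
  proof (rule lipschitz_onI)
    fix x y :: "real^'n"
    obtain k where k: "k \<in> periods Torus" "x - k \<in> cell Torus" using ex1_period_cell by metis
    obtain l where l: "l \<in> periods Torus" "y - l \<in> cell Torus" using ex1_period_cell by metis
    have inv: "G t (z - k) = G t z" if "k \<in> periods Torus" for z k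
      using per[OF t] uminus_periods[OF that] unfolding config_invariant_def
      by (metis add_uminus_conv_diff)
    have xk: "norm (x - k) \<le> r" and yl: "norm (y - l) \<le> r"
      using bounded_cell_Torus[where 'n = 'n] k l by (auto simp: r_def simp del: cell.simps)
    show "dist (G t x) (G t y) \<le> L * (1 + 2 * r) * dist x y"
    proof (cases "dist x y \<le> 1")
      \<comment> \<open>The period of \<open>x\<close> serves both points; \<open>y - k\<close>
        leaves the ball of radius \<open>r\<close> by at most 1.\<close>
      case True
      have "norm (y - k) \<le> r + 1"
        using xk True norm_triangle_ineq[of "x - k" "y - x"] by (simp add: dist_norm norm_minus_commute)
      then have "dist (G t (x - k)) (G t (y - k)) \<le> L * dist (x - k) (y - k)"
        using xk by (intro lipschitz_onD[OF L[OF t]]) auto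
      also have "\<dots> = L * dist x y" by (simp add: dist_norm)
      also have "\<dots> \<le> L * (1 + 2 * r) * dist x y"
        using L0 by (intro mult_right_mono) (auto simp: r_def algebra_simps)
      finally show ?thesis by (simp only: inv[OF k(1)])
    next
      \<comment> \<open>The two representatives differ by at most \<open>2 * r\<close>, and the
        distance of \<open>x\<close> and \<open>y\<close> exceeds 1, so a bound on the difference of
        the forces suffices.\<close>
      case False
      have "dist (G t (x - k)) (G t (y - l)) \<le> L * dist (x - k) (y - l)"
        using xk yl by (intro lipschitz_onD[OF L[OF t]]) auto
      also have "\<dots> \<le> L * (2 * r)"
        using xk yl L0 norm_triangle_ineq4[of "x - k" "y - l"]
        by (intro mult_left_mono) (auto simp: dist_norm)
      also have "\<dots> \<le> L * (1 + 2 * r) * 1" using L0 by (simp add: algebra_simps)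
      also have "\<dots> \<le> L * (1 + 2 * r) * dist x y"
        using False L0 by (intro mult_left_mono) (auto simp: r_def)
      finally show ?thesis by (simp only: inv[OF k(1)] inv[OF l(1)])
    qed
  qed (use L0 in \<open>auto simp: r_def\<close>)
  then show thesis by (rule that)
qed

section \<open>Integration over phase space and equality of distributions\<close>

lemma nn_integral_phase_measure:
  "(\<integral>\<^sup>+ z. h z \<partial>phase_measure X) = (\<integral>\<^sup>+ z. h z * indicator (cell X \<times> UNIV) z \<partial>lborel)"
proof -
  have "cell X \<times> UNIV \<in> sets (borel \<Otimes>\<^sub>M borel :: ((real^'n) \<times> (real^'n)) measure)"
    by (intro pair_measureI borel_cell) simp
  then show ?thesis
    unfolding phase_measure_def borel_prod
    by (subst nn_integral_restrict_space) auto
qed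

text \<open>The hypothesis says that \<open>f\<close> and \<open>g\<close> have the same
  push-forward measure on the line, and every integral in the claim is an integral of
  \<open>\<Phi>\<close> against it.\<close>

lemma equimeasurable_if_emeasure_eq:
  assumes [measurable]: "f \<in> borel_measurable M" "g \<in> borel_measurable M"
    and eq: "\<And>B. B \<in> sets borel \<Longrightarrow>
      (\<integral>\<^sup>+ z. indicator B (f z) \<partial>M) = (\<integral>\<^sup>+ z. indicator B (g z) \<partial>M)"
  shows "equimeasurable M f g"
proof -
  have *: "distr M borel f = distr M borel g"
  proof (rule measure_eqI)
    fix B assume "B \<in> sets (distr M borel f)"
    then have [measurable]: "B \<in> sets borel" by simp
    have "emeasure (distr M borel u) B = (\<integral>\<^sup>+ z. indicator B (u z) \<partial>M)"
      if [measurable]: "u \<in> borel_measurable M" for u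
    proof -
      have "emeasure (distr M borel u) B = (\<integral>\<^sup>+ y. indicator B y \<partial>distr M borel u)" by simp
      also have "\<dots> = (\<integral>\<^sup>+ z. indicator B (u z) \<partial>M)" by (rule nn_integral_distr) measurable
      finally show ?thesis .
    qed
    then show "emeasure (distr M borel f) B = emeasure (distr M borel g) B"
      by (simp add: eq)
  qed simp
  show ?thesis
    unfolding equimeasurable_def
  proof (intro allI impI conjI)
    fix \<Phi> :: "real \<Rightarrow> real" assume [measurable]: "\<Phi> \<in> borel_measurable borel"
    show "(\<integral>\<^sup>+ z. ennreal (\<Phi> (f z)) \<partial>M) = (\<integral>\<^sup>+ z. ennreal (\<Phi> (g z)) \<partial>M)"
      using arg_cong[OF *, of "\<lambda>N. \<integral>\<^sup>+ y. ennreal (\<Phi> y) \<partial>N"] by (simp add: nn_integral_distr)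
    show "integrable M (\<lambda>z. \<Phi> (f z)) \<longleftrightarrow> integrable M (\<lambda>z. \<Phi> (g z))"
      using arg_cong[OF *, of "\<lambda>N. integrable N \<Phi>"] by (simp add: integrable_distr_eq)
    show "(\<integral>z. \<Phi> (f z) \<partial>M) = (\<integral>z. \<Phi> (g z) \<partial>M)"
      using arg_cong[OF *, of "\<lambda>N. \<integral>y. \<Phi> y \<partial>N"] by (simp add: integral_distr)
  qed
qed

theorem proposition2p1:
  fixes X :: config_space
    and f g :: "(real^'n) \<times> (real^'n) \<Rightarrow> real"
    and V :: "real^'n \<Rightarrow> real \<Rightarrow> real"
    and \<rho> :: "real^'n \<Rightarrow> real^'n \<Rightarrow> real \<Rightarrow> real"
  assumes f: "smooth_on_phase_space X f" "\<And>z. f z > 0"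
    and g: "smooth_on_phase_space X g" "\<And>z. g z > 0"
    and mass: "(\<integral>\<^sup>+ z. ennreal (f z) \<partial>phase_measure X) = (\<integral>\<^sup>+ z. ennreal (g z) \<partial>phase_measure X)"
    and V: "potential X V"
    and flow: "X = Euclidean \<Longrightarrow> global_hamiltonian_flow V"
    and \<rho>: "liouville_solution X V \<rho>"
    and initial: "\<And>x v. \<rho> x v 0 = f (x, v)"
    and final: "\<And>x v. \<rho> x v 1 = g (x, v)"
  shows "equimeasurable (phase_measure X) f g"
proof -
  define G where "G t x = - grad (\<lambda>y. V y t) x" for t x
  have newton: "hamiltonian_trajectory V x v \<longleftrightarrow> newton_trajectory 1 G x v" for x v
    unfolding G_def by (rule hamiltonian_trajectory_iff_newton)
  have G: "lipschitz_force G"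
    using potential_lipschitz_force[OF V] by (simp add: G_def[abs_def])
  have periodic: "G t (x + k) = G t x" if "t \<in> {0..1}" "k \<in> periods X" for t x k
    using V that by (auto simp: G_def potential_def config_invariant_def intro!: grad_translate)
  \<comment> \<open>On Euclidean space \<open>flow\<close> is used at times 0 and 1. On the torus
    periodicity makes the force globally Lipschitz; prescribed end data become initial data for the
    reversed system.\<close>
  have traj: "(\<exists>x v. newton_trajectory 1 G x v \<and> (x 0, v 0) = z) \<and>
      (\<exists>x v. newton_trajectory 1 G x v \<and> (x 1, v 1) = z)" for z
  proof (cases X)
    case Euclidean
    then have "\<exists>x v. newton_trajectory 1 G x v \<and> x s = x0 \<and> v s = v0" if "s \<in> {0..1}" for s x0 v0
      using flow that by (simp add: global_hamiltonian_flow_def newton)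
    from this[of 0] this[of 1] show ?thesis by (cases z) auto
  next
    case Torus
    then obtain L where L: "\<And>t. t \<in> {0..1} \<Longrightarrow> L-lipschitz_on UNIV (G t)"
      using periodic_force_lipschitz[OF G] periodic by (auto simp: config_invariant_def)
    have "L-lipschitz_on UNIV (\<lambda>x. - G (1 - t) x)" if "t \<in> {0..1}" for t
      using L[of "1 - t"] that by (auto intro: lipschitz_on_minus)
    from newton_trajectory_exists[OF lipschitz_force_reverse[OF G] this]
    obtain x v where "newton_trajectory (- 1) (\<lambda>t x. - G (1 - t) x) x v" "(x 0, v 0) = z"
      by blast
    from newton_trajectory_reverse[OF this(1)] this(2)
    have "\<exists>x v. newton_trajectory 1 G x v \<and> (x 1, v 1) = z"
      by (intro exI[of _ "\<lambda>t. x (1 - t)"] exI[of _ "\<lambda>t. v (1 - t)"]) simp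
    then show ?thesis using newton_trajectory_exists[OF G L] by blast
  qed
  obtain T where T: "T \<in> borel_measurable borel" "distr lborel borel T = lborel"
    "\<And>x v. newton_trajectory 1 G x v \<Longrightarrow> T (x 0, v 0) = (x 1, v 1)"
    using newton_flow_preserves_lborel[OF G conjunct1[OF traj] conjunct2[OF traj]] by blast
  \<comment> \<open>Shifting the positions of a trajectory by a period gives another trajectory.
    Periods act on positions only, hence the factor \<open>{0}\<close>.\<close>
  have T_periodic: "T (z + k) = T z + k" if k: "k \<in> periods X \<times> {0}" for z k
  proof -
    obtain x v where xv: "newton_trajectory 1 G x v" "(x 0, v 0) = z" using traj[of z] by blast
    then have "newton_trajectory 1 G (\<lambda>t. x t + fst k) v"
      using k by (auto simp: newton_trajectory_def periodic intro!: derivative_eq_intros)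
    from T(3)[OF this] T(3)[OF xv(1)] xv(2) show ?thesis using k by auto
  qed
  have fg: "f z = g (T z)" for z
  proof -
    obtain x v where xv: "newton_trajectory 1 G x v" "(x 0, v 0) = z" using traj[of z] by blast
    then have "\<rho> (x 1) (v 1) 1 = \<rho> (x 0) (v 0) 0"
      using liouville_constant_along_trajectory[OF \<rho>] newton by blast
    then show ?thesis using T(3)[OF xv(1)] xv(2) by (simp add: initial final)
  qed
  \<comment> \<open>The instance \<open>Ck 0\<close> of smoothness is continuity, which gives Borel
    measurability.\<close>
  have meas: "f \<in> borel_measurable borel" "g \<in> borel_measurable borel"
    using f(1) g(1) unfolding smooth_on_phase_space_def
    by (metis Ck.simps(1) borel_measurable_continuous_onI)+
  show ?thesis
  proof (rule equimeasurable_if_emeasure_eq)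
    show "f \<in> borel_measurable (phase_measure X)" "g \<in> borel_measurable (phase_measure X)"
      unfolding phase_measure_def using meas by (auto intro: measurable_restrict_space1)
    fix B :: "real set" assume [measurable]: "B \<in> sets borel"
    note [measurable] = meas
    \<comment> \<open>The change of variables by \<open>T\<close> is carried out on one fundamental
      cell, with the periodic function \<open>indicator B (g z)\<close>; by \<open>fg\<close> the
      left side is the integral for \<open>f\<close>.\<close>
    have "(\<integral>\<^sup>+ z. indicator B (g (T z)) * indicator (cell X \<times> UNIV) z \<partial>lborel)
        = (\<integral>\<^sup>+ z. indicator B (g z) * indicator (cell X \<times> UNIV) z \<partial>lborel)"
    proof (rule nn_integral_fundamental_domain[OF _ _ _ _ T(1,2) T_periodic])
      show "countable (periods X \<times> {0 :: real^'n})" using countable_periods by auto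
      show "- k \<in> periods X \<times> {0}" if "k \<in> periods X \<times> {0}" for k :: "(real^'n) \<times> (real^'n)"
        using that uminus_periods by auto
      show "cell X \<times> UNIV \<in> sets (borel :: ((real^'n) \<times> (real^'n)) measure)"
        unfolding borel_prod[symmetric] by (intro pair_measureI borel_cell) simp
      show "\<exists>!k. k \<in> periods X \<times> {0} \<and> z - k \<in> cell X \<times> UNIV" for z :: "(real^'n) \<times> (real^'n)"
        using ex1_period_cell[of X "fst z"] by (cases z) auto
      show "indicator B (g (z + k)) = (indicator B (g z) :: ennreal)" if "k \<in> periods X \<times> {0}" for k z
        using g(1) that by (cases z) (auto simp: smooth_on_phase_space_def config_invariant_def)
    qed measurable
    then show "(\<integral>\<^sup>+ z. indicator B (f z) \<partial>phase_measure X) = (\<integral>\<^sup>+ z. indicator B (g z) \<partial>phase_measure X)"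
      by (simp add: nn_integral_phase_measure fg)
  qed
qed

end
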